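(* Let $r\ge1$. For real $s>0$, $s$ not an odd integer, and real $k$, \begin{align*} W_r(k;s) &= |k|^s \operatorname{Re} \, {}_{r+1} F_{r} \left( \tfrac{-s}{2}, \tfrac{1-s}{2}, \tfrac{1}{2}, \dots , \tfrac{1}{2}; 1, \dots , 1; \tfrac{4^r}{k^2} \right) \\ &\qquad + \tan\left(\tfrac{\pi s}{2} \right) |k|^s \operatorname{Im} \, {}_{r+1} F_{r} \left( \tfrac{-s}{2}, \tfrac{1-s}{2}, \tfrac{1}{2}, \dots , \tfrac{1}{2}; 1, \dots , 1; \tfrac{4^r}{k^2} \right). \end{align*}
   Context: For $r\ge 1$, real $k$ and real $s>0$, $$W_r(k;s) = \frac{1}{(2 \pi i)^r} \int_{\mathbb{T}^r} \left|k + (x_1 + x_1^{-1}) \cdots (x_r + x_r^{-1}) \right|^s \frac{dx_1}{x_1} \cdots \frac{dx_r}{x_r},$$ $\mathbb{T}^r$ the unit torus. ${}_{r+1}F_r$ is the generalized hypergeometric function (with $r-1$ upper parameters $\frac12$ and $r$ lower parameters $1$ above). For $|k|\ge 2^r$ the expression $|k|^s\,{}_{r+1}F_r(\cdots;4^r/k^2)$ is the convergent (real) series. For $|k|<2^r$ (including $k=0$) the expression $|k|^s\,{}_{r+1}F_r(\cdots;4^r/k^2)$ denotes $\lim_{z\to|k|,\ \operatorname{Im}z>0} z^s\,{}_{r+1}F_r(\cdots;4^r/z^2)$, where $z^s$ is the principal branch and $z\mapsto z^s\,{}_{r+1}F_r(\cdots;4^r/z^2)$ is analytically continued from $\{|z|>2^r,\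 \operatorname{Im}z>0\}$ into the upper half-plane. *)

theory Defs
  imports "HOL-Complex_Analysis.Complex_Analysis"
begin

(* Integral of f(x_1,...,x_r) dx_1 ... dx_r over the unit torus T^r, each circle being
   traversed once counterclockwise: x_j = exp(i t_j), dx_j = i exp(i t_j) dt_j. *)
definition torus_integral :: "nat \<Rightarrow> ((nat \<Rightarrow> complex) \<Rightarrow> complex) \<Rightarrow> complex" where
  "torus_integral r f =
     (LINT t:({1..r} \<rightarrow>\<^sub>E {0..2 * pi})|(\<Pi>\<^sub>M j\<in>{1..r}. lborel).
        f (\<lambda>j. cis (t j)) * (\<Prod>j\<in>{1..r}. \<i> * cis (t j)))"

definition W :: "nat \<Rightarrow> real \<Rightarrow> real \<Rightarrow> complex" where
  "W r k s = 1 / (2 * of_real pi * \<i>) ^ r *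
     torus_integral r (\<lambda>x.
       of_real (cmod (of_real k + (\<Prod>j\<in>{1..r}. x j + inverse (x j))) powr s) /
       (\<Prod>j\<in>{1..r}. x j))"

(* The hypergeometric series pFq(as; bs; z); only meaningful where it converges. The
   coefficients of fps_hypergeo already contain the factor 1/n!. *)
definition hypergeo :: "complex list \<Rightarrow> complex list \<Rightarrow> complex \<Rightarrow> complex" where
  "hypergeo as bs z = eval_fps (fps_hypergeo as bs 1) z"

definition F :: "nat \<Rightarrow> real \<Rightarrow> complex \<Rightarrow> complex" where
  "F r s z = hypergeo
     ([- of_real s / 2, (1 - of_real s) / 2] @ replicate (r - 1) (1 / 2)) (replicate r 1) z"

definition is_continuation :: "nat \<Rightarrow> real \<Rightarrow> (complex \<Rightarrow> complex) \<Rightarrow> bool" where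
  "is_continuation r s G \<longleftrightarrow>
     G holomorphic_on {z. 0 < Im z} \<and>
     (\<forall>z. 0 < Im z \<and> 2 ^ r < cmod z \<longrightarrow> G z = z powr of_real s * F r s (4 ^ r / z\<^sup>2))"

(* On the upper half-plane the continuation does not depend on the choice made by SOME. *)
lemma is_continuation_unique:
  assumes "is_continuation r s G" "is_continuation r s H" "0 < Im z"
  shows "G z = H z"
proof -
  define U where "U = {z :: complex. 0 < Im z}"
  define V where "V = U \<inter> {z. 2 ^ r < cmod z}"
  have U: "open U" "connected U"
    unfolding U_def by (auto simp: open_halfspace_Im_gt intro!: convex_connected convex_halfspace_Im_gt)
  have V: "open V"
    unfolding V_def using U by (intro open_Int open_Collect_less continuous_intros) auto
  have "Complex 0 (2 ^ r + 1) \<in> V"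
    by (auto simp: U_def V_def complex_norm intro: add_pos_pos)
  then have ne: "V \<noteq> {}"
    by blast
  have hol: "G holomorphic_on U" "H holomorphic_on U"
    and eq: "\<And>w. w \<in> V \<Longrightarrow> G w = H w"
    using assms(1,2) by (auto simp: is_continuation_def U_def V_def)
  have z: "z \<in> U"
    using assms(3) by (simp add: U_def)
  have VU: "V \<subseteq> U"
    by (auto simp: V_def)
  show ?thesis
    using analytic_continuation_open[OF V U(1) ne U(2) VU hol eq z] by blast
qed

definition continuation :: "nat \<Rightarrow> real \<Rightarrow> complex \<Rightarrow> complex" where
  "continuation r s = (SOME G. is_continuation r s G)"

(* The expression |k|^s F(4^r/k^2) as a whole. For |k| < 2^r the argument lies on the branch
   cut (1, \<infinity>) of F, and is undefined for k = 0, so there the product is read as a boundary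
   value from the upper half-plane. *)
definition powF :: "nat \<Rightarrow> real \<Rightarrow> real \<Rightarrow> complex" where
  "powF r s k =
     (if 2 ^ r \<le> \<bar>k\<bar> then of_real (\<bar>k\<bar> powr s) * F r s (of_real (4 ^ r / k\<^sup>2))
      else Lim (at (of_real \<bar>k\<bar>) within {z. 0 < Im z}) (continuation r s))"

end

theory Submission
  imports Defs
begin

text \<open>
  Let \<open>X\<close> be the product of the \<open>2 cos t\<^sub>j\<close> for independent angles \<open>t\<^sub>j\<close> uniform in \<open>[0, 2\<pi>]\<close>, so that
  \<open>W\<close> is the expectation of \<open>\<bar>k + X\<bar>\<^sup>s\<close>. The odd moments of \<open>X\<close> vanish and the \<open>2n\<close>-th one is
  \<open>(2n choose n)\<^sup>r\<close>. Integrating the binomial series of \<open>z\<^sup>s (1 + X / z)\<^sup>s\<close> termwise therefore gives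
  \<open>z\<^sup>s F(4\<^sup>r / z\<^sup>2)\<close>, and the holomorphic function \<open>z \<mapsto> E (z + X)\<^sup>s\<close> is its continuation to the upper
  half-plane. Its boundary value at \<open>\<bar>k\<bar>\<close> is \<open>A + exp(i \<pi> s) B\<close>, where \<open>A\<close> and \<open>B\<close> are the contributions
  to \<open>E \<bar>\<bar>k\<bar> + X\<bar>\<^sup>s\<close> of the positive and the negative values of \<open>\<bar>k\<bar> + X\<close>, and
  \<open>cos(\<pi>s) + tan(\<pi>s/2) sin(\<pi>s) = 1\<close> turns this into \<open>A + B\<close>.
\<close>

subsection \<open>The binomial series and complex powers\<close>

text \<open>Eventually \<open>\<bar>s gchoose (n + 1)\<bar>\<close> is the decrement of \<open>\<bar>(s - 1) gchoose n\<bar>\<close>, so the series telescopes.\<close>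

lemma summable_abs_gbinomial:
  fixes s :: real
  assumes "0 < s"
  shows "summable (\<lambda>n. \<bar>s gchoose n\<bar>)"
proof -
  define b where "b = (\<lambda>n. \<bar>(s - 1) gchoose n\<bar>)"
  \<comment> \<open>From index \<open>N\<close> on the factor \<open>real m + 1 - s\<close> is
    positive, so absolute values pass through the recurrences unchanged.\<close>
  obtain N :: nat where N: "s < real N"
    using reals_Archimedean2 by blast
  have telescope: "\<bar>s gchoose (Suc (n + N))\<bar> = b (n + N) - b (Suc (n + N))" for n
  proof -
    define m where "m = n + N"
    have m: "s < real m + 1"
      using N by (simp add: m_def)
    have "(s - 1) gchoose Suc m = - ((real m + 1 - s) / (real m + 1)) * ((s - 1) gchoose m)"
      using gbinomial_absorption[of m "s - 1"] gbinomial_absorb_comp[of "s - 1" m]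
      by (simp add: field_simps)
    then have "b (Suc m) = (real m + 1 - s) / (real m + 1) * b m"
      using m by (simp add: b_def abs_mult)
    moreover have "s gchoose Suc m = s / (real m + 1) * ((s - 1) gchoose m)"
      using gbinomial_absorption[of m s] by (simp add: field_simps)
    then have "\<bar>s gchoose Suc m\<bar> = s / (real m + 1) * b m"
      using assms by (simp add: b_def abs_mult)
    moreover have "(real m + 1 - s) / (real m + 1) = 1 - s / (real m + 1)"
      by (simp add: field_simps)
    ultimately show ?thesis
      unfolding m_def[symmetric] by (simp add: left_diff_distrib)
  qed
  have "summable (\<lambda>n. \<bar>s gchoose (Suc (n + N))\<bar>)"
  proof (rule summableI_nonneg_bounded)
    fix n
    have "(\<Sum>i<n. \<bar>s gchoose (Suc (i + N))\<bar>) = b N - b (n + N)"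
      unfolding telescope by (induction n) auto
    also have "\<dots> \<le> b N"
      by (simp add: b_def)
    finally show "(\<Sum>i<n. \<bar>s gchoose (Suc (i + N))\<bar>) \<le> b N" .
  qed simp
  then show ?thesis
    using summable_iff_shift[of "\<lambda>n. \<bar>s gchoose n\<bar>" "Suc N"] by simp
qed

text \<open>Both sides are continuous on the closed interval, the series by the Weierstrass M-test
  and the power because \<open>0 < s\<close>, and they agree inside. The endpoints are needed for
  \<open>\<bar>k\<bar> = 2 ^ r\<close>.\<close>

lemma gen_binomial_real_closed:
  fixes s y :: real
  assumes "0 < s" "\<bar>y\<bar> \<le> 1"
  shows "(\<lambda>n. (s gchoose n) * y ^ n) sums (1 + y) powr s"
proof -
  define f where "f = (\<lambda>y. \<Sum>n. (s gchoose n) * y ^ n)"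
  have le: "norm ((s gchoose n) * y ^ n) \<le> \<bar>s gchoose n\<bar>" if "y \<in> {-1..1}" for n y
    using that by (auto simp: abs_mult power_abs abs_le_iff intro!: mult_left_le power_le_one)
  have "continuous_on {-1..1} f"
  proof (rule uniform_limit_theorem)
    show "uniform_limit {-1..1} (\<lambda>n y. \<Sum>i<n. (s gchoose i) * y ^ i) f sequentially"
      unfolding f_def using le summable_abs_gbinomial[OF assms(1)] by (rule Weierstrass_m_test)
  qed (auto intro!: always_eventually continuous_intros)
  then have cont: "continuous_on (closure {-1<..<1}) (\<lambda>y. f y - (1 + y) powr s)"
    using assms(1) by (auto intro!: continuous_intros continuous_on_powr')
  have "f y - (1 + y) powr s = 0"
  proof (rule continuous_constant_on_closure[OF cont])
    show "f x - (1 + x) powr s = 0" if "x \<in> {-1<..<1}" for x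
      using that gen_binomial_real[of x s] by (auto simp: f_def sums_iff abs_less_iff)
  qed (use assms in auto)
  moreover have "summable (\<lambda>n. (s gchoose n) * y ^ n)"
    using le[of y] summable_abs_gbinomial[OF assms(1)] assms(2)
    by (intro summable_comparison_test[OF _ summable_abs_gbinomial[OF assms(1)]])
       (auto simp: abs_le_iff)
  ultimately show ?thesis
    by (simp add: f_def sums_iff)
qed

text \<open>Duplication splits \<open>pochhammer (- s) (2 * n)\<close> into the two upper parameters
  depending on \<open>s\<close> and gives \<open>fact (2 * n) = 4 ^ n * p * fact n\<close>. The
  central binomial coefficient is thus \<open>4 ^ n * p / fact n\<close>; of its \<open>r\<close>
  factors \<open>p\<close>, one cancels against the denominator of \<open>s gchoose (2 * n)\<close>,
  leaving \<open>r - 1\<close> parameters 1/2.\<close>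

lemma gbinomial_even_eq_hypergeo_coeff:
  fixes s :: complex
  assumes "1 \<le> r"
  shows "(s gchoose (2 * n)) * of_nat ((2 * n) choose n) ^ r =
    fps_nth (fps_hypergeo ([- s / 2, (1 - s) / 2] @ replicate (r - 1) (1 / 2)) (replicate r 1) 1) n
      * (4 ^ r) ^ n"
proof -
  have foldl_rep: "foldl (\<lambda>x a. x * pochhammer a n) c (replicate m b) = c * pochhammer b n ^ m"
    for b c :: complex and m
    by (induction m arbitrary: c) (auto simp: algebra_simps)
  define p where "p = (pochhammer (1/2) n :: complex)"
  have p: "p \<noteq> 0"
    using fact_double[of n, where 'a = complex] unfolding p_def by auto
  have fd: "(fact (2 * n) :: complex) = 4 ^ n * p * fact n"
    by (simp add: fact_double p_def power_mult)
  have "(of_nat ((2 * n) choose n) :: complex) = fact (2 * n) / (fact n * fact n)"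
    by (simp add: binomial_fact mult_2)
  also have "\<dots> = 4 ^ n * p / fact n"
    by (simp add: fd)
  finally have ch: "(of_nat ((2 * n) choose n) :: complex) = 4 ^ n * p / fact n" .
  have "s gchoose (2 * n) = pochhammer (- s) (2 * n) / fact (2 * n)"
    by (simp add: gbinomial_pochhammer)
  also have "pochhammer (- s) (2 * n) = 4 ^ n * pochhammer (- s / 2) n * pochhammer ((1 - s) / 2) n"
    using pochhammer_double[of "- s / 2" n] by (simp add: power_mult add_divide_distrib diff_divide_distrib)
  finally have g: "s gchoose (2 * n) = pochhammer (- s / 2) n * pochhammer ((1 - s) / 2) n / (p * fact n)"
    by (simp add: fd)
  obtain m where m: "r = Suc m"
    using assms by (cases r) auto
  show ?thesis
    unfolding g ch m using p
    by (simp add: foldl_rep pochhammer_fact[symmetric] p_def[symmetric] power_mult_distrib power_divide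
        field_simps flip: power_mult)
qed

text \<open>The arguments of \<open>z\<close> and \<open>1 + w / z\<close> add up to a number
  between \<open>- pi / 2\<close> and \<open>3 * pi / 2\<close>. A correction by
  \<open>2 * pi\<close> would make the argument of \<open>z + w\<close> negative, but adding the
  real \<open>w\<close> stays in the upper half-plane.\<close>

lemma powr_mult_one_plus:
  fixes z w :: complex and a :: complex
  assumes "0 < Im z" "cmod w < cmod z" "Im w = 0"
  shows "z powr a * (1 + w / z) powr a = (z + w) powr a"
proof -
  define u where "u = 1 + w / z"
  have z: "z \<noteq> 0" using assms by auto
  have "cmod (w / z) < 1"
    using assms z by (simp add: norm_divide)
  then have "Re (w / z) > -1"
    using abs_Re_le_cmod[of "w / z"] by linarith
  then have Re: "Re u > 0"
    by (simp add: u_def)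
  have u: "u \<noteq> 0" using Re by auto
  have zu: "z * u = z + w"
    using z by (simp add: u_def field_simps)
  have "0 < Im (Ln z)" "Im (Ln z) < pi"
    using Im_Ln_pos_lt_imp[OF assms(1)] by auto
  moreover have "\<bar>Im (Ln u)\<bar> < pi / 2"
    using Re by (rule Re_Ln_pos_lt_imp)
  moreover have "0 < Im (Ln (z * u))" "Im (Ln (z * u)) < pi"
    using Im_Ln_pos_lt_imp[of "z * u"] assms by (auto simp: zu)
  ultimately have "Ln (z * u) = Ln z + Ln u"
    using Ln_times[OF z u] by (auto split: if_splits)
  then have "z powr a * u powr a = (z * u) powr a"
    using z u by (simp add: powr_def ring_distribs exp_add)
  then show ?thesis
    unfolding zu unfolding u_def .
qed

lemma sums_even_reindex:
  fixes f :: "nat \<Rightarrow> 'a :: real_normed_vector"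
  assumes "f sums l" "\<And>n. odd n \<Longrightarrow> f n = 0"
  shows "(\<lambda>n. f (2 * n)) sums l"
proof -
  have "strict_mono (\<lambda>n::nat. 2 * n)"
    by (simp add: strict_mono_def)
  then have "(\<lambda>n. f (2 * n)) sums l \<longleftrightarrow> f sums l"
    by (rule sums_mono_reindex) (auto intro!: assms(2) simp: image_iff elim!: evenE)
  then show ?thesis using assms by simp
qed

lemma of_real_gbinomial: "of_real (a gchoose n) = (of_real a gchoose n :: 'a :: {real_div_algebra, field_char_0})"
  by (simp add: gbinomial_prod_rev)

text \<open>The principal power is continuous at positive reals and, as \<open>0 < s\<close>, at 0;
  on the upper side of the cut it picks up the phase \<open>cis (pi * s)\<close>. The two maxima
  merge the cases into one expression that can be integrated over the values of
  \<open>x\<close>.\<close>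

lemma tendsto_powr_upper_half_plane:
  fixes x s :: real
  assumes s: "0 < s"
  shows "((\<lambda>z. z powr of_real s) \<longlongrightarrow>
      of_real (max 0 x powr s) + cis (pi * s) * of_real (max 0 (- x) powr s))
    (at (of_real x) within {z. 0 < Im z})"
proof (cases "0 \<le> x")
  case True
  have "((\<lambda>z. z powr of_real s) \<longlongrightarrow> complex_of_real x powr of_real s) (at (of_real x) within {z. 0 < Im z})"
    using True s by (intro tendsto_intros) (auto simp: complex_nonpos_Reals_iff less_le)
  then show ?thesis
    using True by (cases "x = 0") (simp_all add: powr_of_real)
next
  case False
  have "((\<lambda>z. (- z) powr of_real s) \<longlongrightarrow> (- complex_of_real x) powr of_real s)
      (at (of_real x) within {z. 0 < Im z})"
    using False by (intro tendsto_intros) (auto simp: complex_nonpos_Reals_iff)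
  moreover have "(- complex_of_real x) powr of_real s = of_real ((- x) powr s)"
    using False by (simp add: powr_of_real flip: of_real_minus)
  ultimately have "((\<lambda>z. cis (pi * s) * (- z) powr of_real s) \<longlongrightarrow> cis (pi * s) * of_real ((- x) powr s))
      (at (of_real x) within {z. 0 < Im z})"
    by (intro tendsto_mult tendsto_const) simp
  \<comment> \<open>Rotating by half a turn moves the point off the cut: near a negative
    \<open>x\<close>, \<open>- z\<close> is close to a positive real.\<close>
  moreover have "cis (pi * s) * (- z) powr of_real s = z powr of_real s" if "0 < Im z" for z
  proof -
    have "z \<noteq> 0" using that by auto
    then have "Ln z = Ln (- z) + \<i> * pi"
      using that Ln_minus[of z] by simp
    then show ?thesis
      using \<open>z \<noteq> 0\<close> by (simp add: powr_def cis_conv_exp algebra_simps flip: exp_add)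
  qed
  ultimately have "((\<lambda>z. z powr of_real s) \<longlongrightarrow> cis (pi * s) * of_real ((- x) powr s))
      (at (of_real x) within {z. 0 < Im z})"
    by (elim Lim_transform_eventually) (auto simp: eventually_at_filter)
  then show ?thesis
    using False by (simp add: max_def)
qed

lemma cos_add_tan_half_mult_sin:
  fixes x :: real
  assumes "cos (x / 2) \<noteq> 0"
  shows "cos x + tan (x / 2) * sin x = 1"
proof -
  have "sin x = 2 * sin (x / 2) * cos (x / 2)" "cos x = 1 - 2 * (sin (x / 2))\<^sup>2"
    using sin_double[of "x / 2"] cos_double_sin[of "x / 2"] by simp_all
  then show ?thesis
    using assms by (simp add: tan_def power2_eq_square)
qed

lemma continuous_on_max_powr:
  fixes f :: "'a :: topological_space \<Rightarrow> real"
  assumes "0 < s" "continuous_on A f"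
  shows "continuous_on A (\<lambda>y. max 0 (f y) powr s)"
  by (rule continuous_on_powr') (use assms in \<open>auto intro!: continuous_intros\<close>)

lemma max_powr_add_max_minus_powr:
  fixes x s :: real
  shows "max 0 x powr s + max 0 (- x) powr s = \<bar>x\<bar> powr s"
  by (simp add: max_def abs_if)

subsection \<open>Bounded variables with the moments of a product of cosines\<close>

context finite_measure
begin

text \<open>The majorants \<open>norm (a n) * R ^ n\<close> do not depend on \<open>x\<close>, and
  constants are integrable for a finite measure. Summability is asked at \<open>R\<close> itself, so
  a series on its circle of convergence is allowed.\<close>

lemma sums_integral_power_series:
  fixes X :: "'a \<Rightarrow> real" and a :: "nat \<Rightarrow> complex"
  assumes [measurable]: "X \<in> borel_measurable M"
    and bound: "\<And>x. \<bar>X x\<bar> \<le> R"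
    and a: "summable (\<lambda>n. norm (a n) * R ^ n)"
  shows "(\<lambda>n. a n * of_real (\<integral>x. X x ^ n \<partial>M)) sums (\<integral>x. (\<Sum>n. a n * of_real (X x) ^ n) \<partial>M)"
proof -
  have pow: "\<bar>X x ^ n\<bar> \<le> R ^ n" for x n
    using bound[of x] by (auto simp: power_abs intro!: power_mono)
  have int: "integrable M (\<lambda>x. X x ^ n)" for n
    using pow by (intro integrable_const_bound[of _ "R ^ n"]) auto
  have int': "integrable M (\<lambda>x. complex_of_real (X x) ^ n)" for n
    using integrable_of_real[OF int[of n], where 'a = complex] by simp
  have le: "norm (a n * of_real (X x) ^ n) \<le> norm (a n) * R ^ n" for n x
    using pow[of x n] by (auto simp: norm_mult norm_power power_abs intro!: mult_left_mono)
  have "(\<lambda>n. \<integral>x. a n * of_real (X x) ^ n \<partial>M) sums (\<integral>x. (\<Sum>n. a n * of_real (X x) ^ n) \<partial>M)"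
  proof (rule sums_integral)
    show "integrable M (\<lambda>x. a n * of_real (X x) ^ n)" for n
      using int' by simp
    show "AE x in M. summable (\<lambda>n. norm (a n * of_real (X x) ^ n))"
      using le by (intro AE_I2 summable_comparison_test'[OF a, of 0]) auto
    have "norm (\<integral>x. norm (a n * of_real (X x) ^ n) \<partial>M) \<le> measure M (space M) * (norm (a n) * R ^ n)" for n
    proof -
      have "(\<integral>x. norm (a n * of_real (X x) ^ n) \<partial>M) \<le> (\<integral>x. norm (a n) * R ^ n \<partial>M)"
        using le int' by (intro integral_mono integrable_norm) auto
      then show ?thesis by simp
    qed
    then show "summable (\<lambda>n. \<integral>x. norm (a n * of_real (X x) ^ n) \<partial>M)"
      using a by (intro summable_comparison_test'[OF summable_mult[OF a], of 0 _ "measure M (space M)"]) auto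
  qed
  moreover have "(\<integral>x. a n * of_real (X x) ^ n \<partial>M) = a n * of_real (\<integral>x. X x ^ n \<partial>M)" for n
    unfolding of_real_power[symmetric] integral_mult_right_zero integral_complex_of_real ..
  ultimately show ?thesis by (simp only:)
qed

section \<open>Holomorphy of integrated complex powers\<close>

lemma powr_shift_measurable:
  fixes X :: "'a \<Rightarrow> real"
  assumes [measurable]: "X \<in> borel_measurable M" and "0 < Im z"
  shows "(\<lambda>x. (z + of_real (X x)) powr a) \<in> borel_measurable M"
proof -
  have "continuous_on UNIV (\<lambda>x::real. (z + of_real x) powr a)"
    using assms(2) by (intro continuous_intros) (auto simp: complex_eq_iff)
  then show ?thesis
    using measurable_compose[OF assms(1) borel_measurable_continuous_onI] by blast
qed

text \<open>Differentiation under the integral sign: away from the real axis the difference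
  quotients are bounded uniformly in \<open>x\<close>, so dominated convergence applies.\<close>

lemma holomorphic_integral_powr:
  fixes X :: "'a \<Rightarrow> real" and a :: complex
  assumes X: "X \<in> borel_measurable M"
    and bound: "\<And>x. \<bar>X x\<bar> \<le> R"
  shows "(\<lambda>z. \<integral>x. (z + of_real (X x)) powr a \<partial>M) holomorphic_on {z. 0 < Im z}"
proof (rule holomorphic_onI)
  fix z assume "z \<in> {z. 0 < Im z}"
  then have z: "0 < Im z" by simp
  \<comment> \<open>Half the height of \<open>z\<close> keeps the whole ball, and all its real
    translates, at distance at least \<open>d\<close> from the branch cut.\<close>
  define d where "d = Im z / 2"
  have d: "d > 0" using z by (simp add: d_def)
  have Im_ge: "Im w \<ge> d" if "w \<in> cball z d" for w
    using that abs_Im_le_cmod[of "z - w"] by (simp add: d_def dist_norm)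
  \<comment> \<open>One compact set contains all translates of the ball by values of
    \<open>X\<close>, which makes the bounds \<open>B\<close> and \<open>C\<close> below independent
    of \<open>x\<close>.\<close>
  define K where "K = {w. d \<le> Im w} \<inter> cball 0 (cmod z + d + R)"
  have K: "w + of_real (X x) \<in> K" if "w \<in> cball z d" for w x
  proof -
    have "cmod w \<le> cmod z + d"
      using that norm_triangle_ineq2[of w z] by (simp add: dist_norm norm_minus_commute)
    moreover have "cmod (w + of_real (X x)) \<le> cmod w + cmod (of_real (X x))"
      by (rule norm_triangle_ineq)
    ultimately show ?thesis
      using Im_ge[OF that] bound[of x] by (simp add: K_def)
  qed
  have "compact K"
    unfolding K_def by (intro closed_Int_compact closed_halfspace_Im_ge compact_cball)
  moreover have "continuous_on K (\<lambda>w. a * w powr (a - 1))"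
    using d by (intro continuous_intros) (auto simp: K_def)
  ultimately have "bounded ((\<lambda>w. a * w powr (a - 1)) ` K)"
    by (intro compact_imp_bounded compact_continuous_image)
  then obtain B where B: "\<And>w. w \<in> K \<Longrightarrow> norm (a * w powr (a - 1)) \<le> B"
    unfolding bounded_iff by blast
  have deriv: "((\<lambda>w. (w + of_real (X x)) powr a) has_field_derivative a * (w + of_real (X x)) powr (a - 1)) (at w)"
    if "Im w > 0" for w x
    using that by (auto intro!: derivative_eq_intros simp: complex_nonpos_Reals_iff)
  have "bounded ((\<lambda>w. w powr a) ` K)"
    using \<open>compact K\<close> d
    by (intro compact_imp_bounded compact_continuous_image continuous_intros) (auto simp: K_def)
  then obtain C where C: "\<And>w. w \<in> K \<Longrightarrow> norm (w powr a) \<le> C"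
    unfolding bounded_iff by blast
  have int: "integrable M (\<lambda>x. (w + of_real (X x)) powr a)" if "w \<in> cball z d" for w
    using K[OF that] C powr_shift_measurable[OF X, of w a] Im_ge[OF that] d
    by (intro integrable_const_bound[of _ C]) auto
  define q where "q = (\<lambda>w x. ((w + of_real (X x)) powr a - (z + of_real (X x)) powr a) / (w - z))"
  have q_le: "norm (q w x) \<le> B" if "w \<in> cball z d" "w \<noteq> z" for w x
  proof -
    have "norm ((w + of_real (X x)) powr a - (z + of_real (X x)) powr a) \<le> B * norm (w - z)"
    proof (rule field_differentiable_bound[where S = "cball z d"
          and f = "\<lambda>w. (w + of_real (X x)) powr a" and f' = "\<lambda>w. a * (w + of_real (X x)) powr (a - 1)"])
      fix u assume u: "u \<in> cball z d"
      show "((\<lambda>w. (w + of_real (X x)) powr a) has_field_derivative a * (u + of_real (X x)) powr (a - 1))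
          (at u within cball z d)"
        by (rule has_field_derivative_at_within[OF deriv[OF less_le_trans[OF d Im_ge[OF u]]]])
      show "norm (a * (u + of_real (X x)) powr (a - 1)) \<le> B"
        by (rule B[OF K[OF u]])
    next
      show "w \<in> cball z d" by fact
      show "z \<in> cball z d" using d by simp
    qed (rule convex_cball)
    then show ?thesis
      using that by (simp add: q_def norm_divide pos_divide_le_eq)
  qed
  have "((\<lambda>z. \<integral>x. (z + of_real (X x)) powr a \<partial>M) has_field_derivative
      (\<integral>x. a * (z + of_real (X x)) powr (a - 1) \<partial>M)) (at z)"
    unfolding has_field_derivative_iff
  proof (rule Lim_transform_within)
    show "((\<lambda>w. \<integral>x. q w x \<partial>M) \<longlongrightarrow> (\<integral>x. a * (z + of_real (X x)) powr (a - 1) \<partial>M)) (at z)"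
      unfolding tendsto_at_iff_sequentially comp_def
    proof (intro allI impI)
      fix S :: "nat \<Rightarrow> complex"
      assume S: "\<forall>i. S i \<in> UNIV - {z}" "S \<longlonglongrightarrow> z"
      have "\<forall>\<^sub>F i in sequentially. S i \<in> cball z d"
        using topological_tendstoD[OF S(2) open_ball[of z d]] d by (auto elim!: eventually_mono)
      then obtain N where N: "\<And>n. n \<ge> N \<Longrightarrow> S n \<in> cball z d"
        by (auto simp: eventually_sequentially)
      show "(\<lambda>n. \<integral>x. q (S n) x \<partial>M) \<longlonglongrightarrow> (\<integral>x. a * (z + of_real (X x)) powr (a - 1) \<partial>M)"
      \<comment> \<open>The first \<open>N\<close> terms are dropped because the bound
        \<open>B\<close> holds only inside the ball.\<close>
      proof (rule LIMSEQ_offset, rule integral_dominated_convergence[where w = "\<lambda>_. B"])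
        have [measurable]: "(\<lambda>x. (z + of_real (X x)) powr b) \<in> borel_measurable M" for b
          using powr_shift_measurable[OF X z] .
        show "(\<lambda>x. a * (z + of_real (X x)) powr (a - 1)) \<in> borel_measurable M"
          by measurable
        have [measurable]: "(\<lambda>x. (S (n + N) + of_real (X x)) powr a) \<in> borel_measurable M" for n
          using N[of "n + N"] Im_ge[of "S (n + N)"] d by (intro powr_shift_measurable X) auto
        show "q (S (n + N)) \<in> borel_measurable M" for n
          unfolding q_def by measurable
        show "integrable M (\<lambda>_. B)" by simp
        show "AE x in M. norm (q (S (n + N)) x) \<le> B" for n
          using q_le N[of "n + N"] S(1) by (intro AE_I2) auto
        show "AE x in M. (\<lambda>n. q (S (n + N)) x) \<longlonglongrightarrow> a * (z + of_real (X x)) powr (a - 1)"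
        proof (rule AE_I2)
          fix x
          have "((\<lambda>w. q w x) \<longlongrightarrow> a * (z + of_real (X x)) powr (a - 1)) (at z)"
            using deriv[OF z, of x] unfolding has_field_derivative_iff q_def .
          then have "(\<lambda>n. q (S n) x) \<longlonglongrightarrow> a * (z + of_real (X x)) powr (a - 1)"
            using S by (auto simp: tendsto_at_iff_sequentially comp_def)
          then show "(\<lambda>n. q (S (n + N)) x) \<longlonglongrightarrow> a * (z + of_real (X x)) powr (a - 1)"
            by (rule LIMSEQ_ignore_initial_segment)
        qed
      qed
    qed
    show "0 < d" by fact
    show "(\<integral>x. q w x \<partial>M) = ((\<integral>x. (w + of_real (X x)) powr a \<partial>M) - (\<integral>x. (z + of_real (X x)) powr a \<partial>M)) / (w - z)"
      if "w \<in> UNIV" "0 < dist w z" "dist w z < d" for w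
      using that int[of w] int[of z] d by (simp add: q_def dist_commute)
  qed
  then show "(\<lambda>z. \<integral>x. (z + of_real (X x)) powr a \<partial>M) field_differentiable at z within {z. 0 < Im z}"
    using field_differentiable_at_within field_differentiable_def by blast
qed

end

text \<open>Only boundedness and the moments of the product of cosines are kept, so that the results
  apply to the product and to its negative alike. The moment for \<open>n = 0\<close> says that the
  total mass is 1.\<close>

locale binomial_moments = finite_measure M for M :: "'a measure" +
  fixes r :: nat and X :: "'a \<Rightarrow> real"
  assumes r: "1 \<le> r"
    and X[measurable]: "X \<in> borel_measurable M"
    and bound: "\<bar>X x\<bar> \<le> 2 ^ r"
    and moment: "(\<integral>x. X x ^ n \<partial>M) = (if even n then of_nat (n choose (n div 2)) ^ r else 0)"
begin

text \<open>Termwise integration leaves the even moments, whose products with the binomial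
  coefficients are the hypergeometric ones. The circle \<open>cmod z = 2 ^ r\<close> is included
  since the binomial coefficients are absolutely summable, and \<open>z\<close> may be real.\<close>

lemma F_eq_integral:
  fixes z :: complex
  assumes s: "0 < s" and z: "2 ^ r \<le> cmod z"
  shows "F r s (4 ^ r / z\<^sup>2) = (\<integral>x. (\<Sum>n. (of_real s gchoose n) * (of_real (X x) / z) ^ n) \<partial>M)"
proof -
  define c where "c = (\<lambda>n. of_real s gchoose n :: complex)"
  have z0: "cmod z > 0"
    using z by (rule less_le_trans[rotated]) simp
  have "(\<lambda>n. c n / z ^ n * of_real (\<integral>x. X x ^ n \<partial>M)) sums
      (\<integral>x. (\<Sum>n. c n / z ^ n * of_real (X x) ^ n) \<partial>M)"
  proof (rule sums_integral_power_series[OF X bound])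
    have "norm (c n / z ^ n) * (2 ^ r) ^ n \<le> \<bar>s gchoose n\<bar>" for n
    proof -
      have "norm (c n) = \<bar>s gchoose n\<bar>"
        by (simp add: c_def flip: of_real_gbinomial)
      moreover have "(2 ^ r) ^ n / cmod z ^ n \<le> 1"
        using z z0 by (simp add: power_mono)
      from mult_left_mono[OF this, of "\<bar>s gchoose n\<bar>"]
      have "\<bar>s gchoose n\<bar> * ((2 ^ r) ^ n / cmod z ^ n) \<le> \<bar>s gchoose n\<bar> * 1"
        by simp
      ultimately show ?thesis
        by (simp add: norm_divide norm_power)
    qed
    then show "summable (\<lambda>n. norm (c n / z ^ n) * (2 ^ r) ^ n)"
      by (intro summable_comparison_test'[OF summable_abs_gbinomial[OF s], of 0]) auto
  qed
  then have "(\<lambda>n. c (2 * n) / z ^ (2 * n) * of_real (\<integral>x. X x ^ (2 * n) \<partial>M)) sums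
      (\<integral>x. (\<Sum>n. c n / z ^ n * of_real (X x) ^ n) \<partial>M)"
    by (rule sums_even_reindex) (simp add: moment)
  also have "(\<lambda>n. c (2 * n) / z ^ (2 * n) * of_real (\<integral>x. X x ^ (2 * n) \<partial>M)) =
      (\<lambda>n. fps_nth (fps_hypergeo ([- of_real s / 2, (1 - of_real s) / 2] @ replicate (r - 1) (1 / 2))
         (replicate r 1) 1) n * (4 ^ r / z\<^sup>2) ^ n)"
  proof
    fix n
    have "(\<integral>x. X x ^ (2 * n) \<partial>M) = of_nat ((2 * n) choose n) ^ r"
      using moment[of "2 * n"] by simp
    then show "c (2 * n) / z ^ (2 * n) * of_real (\<integral>x. X x ^ (2 * n) \<partial>M) =
      fps_nth (fps_hypergeo ([- of_real s / 2, (1 - of_real s) / 2] @ replicate (r - 1) (1 / 2))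
         (replicate r 1) 1) n * (4 ^ r / z\<^sup>2) ^ n"
      using gbinomial_even_eq_hypergeo_coeff[OF r, of "of_real s" n]
      by (simp add: c_def power_divide power_mult del: fps_hypergeo_nth)
  qed
  finally show ?thesis
    by (simp add: F_def hypergeo_def eval_fps_def sums_iff c_def power_divide del: fps_hypergeo_nth)
qed

text \<open>Outside the disc the inner series is \<open>(1 + X x / z) powr s\<close>, and the factor
  \<open>z powr s\<close> can be absorbed into it; the resulting integral makes sense on the whole
  half-plane.\<close>

lemma is_continuation_integral:
  assumes s: "0 < s"
  shows "is_continuation r s (\<lambda>z. \<integral>x. (z + of_real (X x)) powr of_real s \<partial>M)"
  unfolding is_continuation_def
proof (intro conjI allI impI)
  show "(\<lambda>z. \<integral>x. (z + of_real (X x)) powr of_real s \<partial>M) holomorphic_on {z. 0 < Im z}"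
    by (rule holomorphic_integral_powr[OF X bound])
next
  fix z assume "0 < Im z \<and> 2 ^ r < cmod z"
  then have z: "0 < Im z" "2 ^ r < cmod z" by auto
  have eq: "z powr of_real s * (\<Sum>n. (of_real s gchoose n) * (of_real (X x) / z) ^ n) =
      (z + of_real (X x)) powr of_real s" for x
  proof -
    have less: "cmod (of_real (X x)) < cmod z"
      using bound[of x] z by simp
    moreover have "0 < cmod z"
      using z(1) by auto
    ultimately have "norm (of_real (X x) / z) < 1"
      by (simp add: norm_divide)
    from gen_binomial_complex[OF this, of "of_real s"] show ?thesis
      using powr_mult_one_plus[OF z(1) less] by (simp add: sums_iff)
  qed
  have "z powr of_real s * F r s (4 ^ r / z\<^sup>2) =
      z powr of_real s * (\<integral>x. (\<Sum>n. (of_real s gchoose n) * (of_real (X x) / z) ^ n) \<partial>M)"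
    using z F_eq_integral[OF s, of z] by simp
  also have "\<dots> = (\<integral>x. (z + of_real (X x)) powr of_real s \<partial>M)"
    by (simp flip: eq)
  finally show "(\<integral>x. (z + of_real (X x)) powr of_real s \<partial>M) = z powr of_real s * F r s (4 ^ r / z\<^sup>2)" ..
qed

section \<open>Boundary values on the real axis\<close>

lemma integrable_continuous_compose:
  fixes f :: "real \<Rightarrow> real"
  assumes "continuous_on UNIV f"
  shows "integrable M (\<lambda>x. f (X x))"
proof -
  have "compact (f ` {- (2 ^ r)..2 ^ r})"
    by (intro compact_continuous_image continuous_on_subset[OF assms]) auto
  then obtain C where C: "\<And>y. y \<in> {- (2 ^ r)..2 ^ r} \<Longrightarrow> norm (f y) \<le> C"
    using compact_imp_bounded[of "f ` {- (2 ^ r)..2 ^ r}"] unfolding bounded_iff by blast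
  show ?thesis
  proof (rule integrable_const_bound)
    show "AE x in M. norm (f (X x)) \<le> C"
    proof (intro AE_I2 C)
      show "X x \<in> {- (2 ^ r)..2 ^ r}" for x
        using bound[of x] by (simp add: abs_le_iff minus_le_iff)
    qed
    show "(\<lambda>x. f (X x)) \<in> borel_measurable M"
      by (rule measurable_compose[OF X borel_measurable_continuous_onI[OF assms]])
  qed
qed

lemma tendsto_integral_powr:
  fixes k s :: real
  assumes s: "0 < s"
  shows "((\<lambda>z. \<integral>x. (z + of_real (X x)) powr of_real s \<partial>M) \<longlongrightarrow>
      of_real (\<integral>x. max 0 (k + X x) powr s \<partial>M)
        + cis (pi * s) * of_real (\<integral>x. max 0 (- (k + X x)) powr s \<partial>M))
    (at (of_real k) within {z. 0 < Im z})"
proof -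
  have cont: "continuous_on UNIV (\<lambda>y. max 0 (k + y) powr s)" "continuous_on UNIV (\<lambda>y. max 0 (- (k + y)) powr s)"
    using s by (auto intro!: continuous_on_max_powr continuous_intros)
  define h where "h = (\<lambda>x. complex_of_real (max 0 (k + X x) powr s)
      + cis (pi * s) * of_real (max 0 (- (k + X x)) powr s))"
  have int: "integrable M (\<lambda>x. complex_of_real (max 0 (k + X x) powr s))"
    "integrable M (\<lambda>x. complex_of_real (max 0 (- (k + X x)) powr s))"
    using integrable_continuous_compose[OF cont(1)] integrable_continuous_compose[OF cont(2)] by (auto intro: integrable_of_real)
  have "((\<lambda>z. \<integral>x. (z + of_real (X x)) powr of_real s \<partial>M) \<longlongrightarrow> (\<integral>x. h x \<partial>M))
      (at (of_real k) within {z. 0 < Im z})"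
    unfolding tendsto_at_iff_sequentially comp_def
  proof (intro allI impI)
    fix S :: "nat \<Rightarrow> complex"
    assume S: "\<forall>i. S i \<in> {z. 0 < Im z} - {of_real k}" "S \<longlonglongrightarrow> of_real k"
    obtain C where C: "\<And>n. norm (S n) \<le> C"
      using convergent_imp_Bseq[OF convergentI[OF S(2)]] by (rule BseqE) auto
    show "(\<lambda>n. \<integral>x. (S n + of_real (X x)) powr of_real s \<partial>M) \<longlonglongrightarrow> (\<integral>x. h x \<partial>M)"
    proof (rule integral_dominated_convergence[where w = "\<lambda>_. (C + 2 ^ r) powr s"])
      show "h \<in> borel_measurable M"
        unfolding h_def by measurable
      show "(\<lambda>x. (S n + of_real (X x)) powr of_real s) \<in> borel_measurable M" for n
        using S(1) by (intro powr_shift_measurable X) auto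
      show "AE x in M. (\<lambda>n. (S n + of_real (X x)) powr of_real s) \<longlonglongrightarrow> h x"
      proof (rule AE_I2)
        fix x
        \<comment> \<open>A real translation keeps the sequence strictly above the axis, so the
          one-sided limit of the power applies at \<open>k + X x\<close>, whatever its sign.\<close>
        have "filterlim (\<lambda>n. S n + of_real (X x)) (at (of_real (k + X x)) within {z. 0 < Im z}) sequentially"
        proof -
          have "0 < Im (S n)" for n
            using S(1) by simp
          then have "0 < Im (S n + of_real (X x))" "S n + of_real (X x) \<noteq> of_real (k + X x)" for n
            by (simp, metis Im_complex_of_real add_right_imp_eq less_irrefl of_real_add)
          then show ?thesis
            unfolding filterlim_at
            by (auto intro!: tendsto_eq_intros S(2) always_eventually)
        qed
        from filterlim_compose[OF tendsto_powr_upper_half_plane[OF s] this]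
        show "(\<lambda>n. (S n + of_real (X x)) powr of_real s) \<longlonglongrightarrow> h x"
          by (simp add: h_def)
      qed
      show "AE x in M. norm ((S n + of_real (X x)) powr of_real s) \<le> (C + 2 ^ r) powr s" for n
      proof (rule AE_I2)
        fix x
        have "norm (S n + of_real (X x)) \<le> C + 2 ^ r"
          using norm_triangle_ineq[of "S n" "of_real (X x)"] C[of n] bound[of x] by simp
        then show "norm ((S n + of_real (X x)) powr of_real s) \<le> (C + 2 ^ r) powr s"
          using s by (simp add: norm_powr_complex powr_mono2)
      qed
    qed simp
  qed
  also have "(\<integral>x. h x \<partial>M) = of_real (\<integral>x. max 0 (k + X x) powr s \<partial>M)
        + cis (pi * s) * of_real (\<integral>x. max 0 (- (k + X x)) powr s \<partial>M)"
    unfolding h_def using int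
    by (subst Bochner_Integration.integral_add) (auto simp del: of_real_minus)
  finally show ?thesis .
qed

text \<open>For \<open>2 ^ r \<le> \<bar>k\<bar>\<close> the sum \<open>\<bar>k\<bar> + X x\<close>
  is nonnegative and \<open>powF\<close> is real, so the tangent term vanishes. For smaller
  \<open>\<bar>k\<bar>\<close> the boundary value is used.\<close>

lemma integral_abs_powr:
  fixes k s :: real
  assumes s: "0 < s" "\<And>n::int. odd n \<Longrightarrow> s \<noteq> of_int n"
  shows "(\<integral>x. \<bar>\<bar>k\<bar> + X x\<bar> powr s \<partial>M) = Re (powF r s k) + tan (pi * s / 2) * Im (powF r s k)"
proof (cases "2 ^ r \<le> \<bar>k\<bar>")
  case True
  then have k: "0 < \<bar>k\<bar>"
    by (rule less_le_trans[rotated]) simp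
  have eq: "of_real (\<bar>k\<bar> powr s) * (\<Sum>n. (of_real s gchoose n) * (of_real (X x) / of_real \<bar>k\<bar>) ^ n)
      = complex_of_real (\<bar>\<bar>k\<bar> + X x\<bar> powr s)" for x
  proof -
    have le: "\<bar>X x\<bar> \<le> \<bar>k\<bar>"
      using True bound[of x] by linarith
    then have "\<bar>X x / \<bar>k\<bar>\<bar> \<le> 1"
      using k by (simp add: abs_divide)
    from gen_binomial_real_closed[OF s(1) this]
    have "(\<lambda>n. (s gchoose n) * (X x / \<bar>k\<bar>) ^ n) sums (1 + X x / \<bar>k\<bar>) powr s" .
    then have "(\<lambda>n. complex_of_real ((s gchoose n) * (X x / \<bar>k\<bar>) ^ n)) sums of_real ((1 + X x / \<bar>k\<bar>) powr s)"
      by (rule sums_of_real)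
    moreover have "\<bar>k\<bar> powr s * (1 + X x / \<bar>k\<bar>) powr s = \<bar>\<bar>k\<bar> + X x\<bar> powr s"
    proof -
      have "\<bar>k\<bar> * (1 + X x / \<bar>k\<bar>) = \<bar>k\<bar> + X x" "0 \<le> 1 + X x / \<bar>k\<bar>"
        using k le by (auto simp: field_simps)
      then show ?thesis
        using le by (metis abs_of_nonneg abs_ge_zero powr_mult mult_nonneg_nonneg)
    qed
    ultimately show ?thesis
      by (simp add: sums_iff of_real_gbinomial) (simp flip: of_real_mult)
  qed
  have "powF r s k = of_real (\<bar>k\<bar> powr s) * F r s (4 ^ r / (of_real \<bar>k\<bar>)\<^sup>2)"
  proof -
    have "(complex_of_real \<bar>k\<bar>)\<^sup>2 = (of_real k)\<^sup>2"
      by (simp flip: of_real_power)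
    then show ?thesis
      using True by (simp add: powF_def)
  qed
  also have "F r s (4 ^ r / (of_real \<bar>k\<bar>)\<^sup>2) =
      (\<integral>x. (\<Sum>n. (of_real s gchoose n) * (of_real (X x) / of_real \<bar>k\<bar>) ^ n) \<partial>M)"
    using F_eq_integral[OF s(1), of "of_real \<bar>k\<bar>"] True by simp
  also have "of_real (\<bar>k\<bar> powr s) * \<dots> = complex_of_real (\<integral>x. \<bar>\<bar>k\<bar> + X x\<bar> powr s \<partial>M)"
    by (simp only: eq integral_complex_of_real flip: integral_mult_right_zero)
  finally show ?thesis by simp
next
  case False
  define A where "A = (\<integral>x. max 0 (\<bar>k\<bar> + X x) powr s \<partial>M)"
  define B where "B = (\<integral>x. max 0 (- (\<bar>k\<bar> + X x)) powr s \<partial>M)"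
  \<comment> \<open>The integral witnesses existence, so the choice is a genuine continuation, and
    uniqueness identifies it with the integral.\<close>
  have "is_continuation r s (continuation r s)"
    unfolding continuation_def by (rule someI[of "is_continuation r s", OF is_continuation_integral[OF s(1)]])
  then have "continuation r s z = (\<integral>x. (z + of_real (X x)) powr of_real s \<partial>M)" if "0 < Im z" for z
    by (rule is_continuation_unique[OF _ is_continuation_integral[OF s(1)] that])
  then have "(continuation r s \<longlongrightarrow> of_real A + cis (pi * s) * of_real B) (at (of_real \<bar>k\<bar>) within {z. 0 < Im z})"
    unfolding A_def B_def
    by (intro Lim_transform_eventually[OF tendsto_integral_powr[OF s(1)]]) (auto simp: eventually_at_filter)
  \<comment> \<open>\<open>Lim\<close> is determined only along a nontrivial filter: the point must
    lie in the closure of the open half-plane.\<close>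
  moreover have "at (complex_of_real \<bar>k\<bar>) within {z. 0 < Im z} \<noteq> bot"
  proof -
    have "{z. 0 < Im z} - {complex_of_real \<bar>k\<bar>} = {z. 0 < Im z}"
      by auto
    then show ?thesis
      using closure_halfspace_gt[of \<i> 0] by (simp add: at_within_eq_bot_iff)
  qed
  ultimately have powF: "powF r s k = of_real A + cis (pi * s) * of_real B"
    using False by (auto simp: powF_def intro!: tendsto_Lim)
  \<comment> \<open>This is where odd integers \<open>s\<close> are excluded.\<close>
  have "cos (pi * s / 2) \<noteq> 0"
    using s(2) by (auto simp: cos_zero_iff_int)
  from cos_add_tan_half_mult_sin[OF this]
  have "(cos (pi * s) + tan (pi * s / 2) * sin (pi * s)) * B = B"
    by simp
  then have "Re (powF r s k) + tan (pi * s / 2) * Im (powF r s k) = A + B"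
    by (simp add: powF algebra_simps)
  also have "\<dots> = (\<integral>x. max 0 (\<bar>k\<bar> + X x) powr s + max 0 (- (\<bar>k\<bar> + X x)) powr s \<partial>M)"
    unfolding A_def B_def using s(1)
    by (intro Bochner_Integration.integral_add[symmetric] integrable_continuous_compose)
       (auto intro!: continuous_on_max_powr continuous_intros)
  finally show ?thesis
    by (simp only: max_powr_add_max_minus_powr)
qed

end

subsection \<open>The torus\<close>

lemma integral_cis_mult:
  fixes m :: int
  shows "(\<integral>t. indicator {0..2 * pi} t *\<^sub>R cis (of_int m * t) \<partial>lborel) = (if m = 0 then 2 * pi else 0)"
proof (cases "m = 0")
  case True
  then show ?thesis by (simp add: scaleR_conv_of_real)
next
  case False
  have "(\<integral>t. indicator {0..2 * pi} t *\<^sub>R cis (of_int m * t) \<partial>lborel) =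
      cis (of_int m * (2 * pi)) / (\<i> * of_int m) - cis (of_int m * 0) / (\<i> * of_int m)"
  proof (rule integral_FTC_Icc)
    show "((\<lambda>t. cis (of_int m * t) / (\<i> * of_int m)) has_vector_derivative cis (of_int m * t))
        (at t within {0..2 * pi})" for t
      unfolding cis_conv_exp using False
      by (auto intro!: derivative_eq_intros has_vector_derivative_real_field simp: field_simps)
  qed (auto intro!: continuous_intros)
  also have "cis (of_int m * (2 * pi)) = 1"
    using cis_multiple_2pi[of "of_int m"] by (simp add: mult_ac)
  finally show ?thesis using False by simp
qed

text \<open>Expanding \<open>(cis t + cis (- t)) ^ n\<close> and using orthogonality of the
  exponentials, only the middle term survives, and it exists only for even \<open>n\<close>.\<close>

lemma integral_two_cos_power:
  "(\<integral>t. indicator {0..2 * pi} t * (2 * cos t) ^ n \<partial>lborel) =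
    2 * pi * (if even n then of_nat (n choose (n div 2)) else 0)"
proof -
  have expand: "complex_of_real ((2 * cos t) ^ n) = (\<Sum>k\<le>n. of_nat (n choose k) * cis (of_int (2 * int k - int n) * t))" for t
  proof -
    have "complex_of_real (2 * cos t) = cis t + cis (- t)"
      by (simp add: complex_eq_iff)
    then have "complex_of_real ((2 * cos t) ^ n) = (cis t + cis (- t)) ^ n"
      by (simp only: of_real_power)
    also have "\<dots> = (\<Sum>k\<le>n. of_nat (n choose k) * cis t ^ k * cis (- t) ^ (n - k))"
      by (rule binomial_ring)
    also have "\<dots> = (\<Sum>k\<le>n. of_nat (n choose k) * cis (of_int (2 * int k - int n) * t))"
    proof (intro sum.cong refl)
      fix k assume "k \<in> {..n}"
      then have "real k * t + real (n - k) * - t = of_int (2 * int k - int n) * t"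
        by (simp add: of_nat_diff algebra_simps)
      then show "of_nat (n choose k) * cis t ^ k * cis (- t) ^ (n - k) =
          of_nat (n choose k) * cis (of_int (2 * int k - int n) * t)"
        by (simp only: Complex.DeMoivre mult.assoc cis_mult)
    qed
    finally show ?thesis .
  qed
  have int: "integrable lborel (\<lambda>t. indicator {0..2 * pi} t *\<^sub>R cis (a * t))" for a :: real
    by (intro borel_integrable_compact continuous_intros) auto
  have "complex_of_real (\<integral>t. indicator {0..2 * pi} t * (2 * cos t) ^ n \<partial>lborel) =
      (\<integral>t. (\<Sum>k\<le>n. of_nat (n choose k) * (indicator {0..2 * pi} t *\<^sub>R cis (of_int (2 * int k - int n) * t))) \<partial>lborel)"
    unfolding integral_complex_of_real[symmetric] of_real_mult expand
    by (simp add: sum_distrib_left scaleR_conv_of_real mult_ac)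
  also have "\<dots> = (\<Sum>k\<le>n. of_nat (n choose k) * (if 2 * int k - int n = 0 then complex_of_real (2 * pi) else 0))"
  proof (subst Bochner_Integration.integral_sum)
    show "integrable lborel (\<lambda>t. of_nat (n choose k) *
        (indicator {0..2 * pi} t *\<^sub>R cis (of_int (2 * int k - int n) * t)))" for k
      using int by (rule integrable_mult_right)
  qed (simp only: integral_mult_right_zero integral_cis_mult if_distrib[of complex_of_real] of_real_0)
  also have "\<dots> = (\<Sum>k\<le>n. if even n \<and> k = n div 2 then of_nat (n choose k) * complex_of_real (2 * pi) else 0)"
  proof (intro sum.cong refl)
    fix k
    have "2 * int k - int n = 0 \<longleftrightarrow> even n \<and> k = n div 2"
      by presburger
    then show "of_nat (n choose k) * (if 2 * int k - int n = 0 then complex_of_real (2 * pi) else 0) =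
        (if even n \<and> k = n div 2 then of_nat (n choose k) * complex_of_real (2 * pi) else 0)"
      by simp
  qed
  also have "\<dots> = complex_of_real (2 * pi * (if even n then of_nat (n choose (n div 2)) else 0))"
    by simp
  finally show ?thesis
    by (simp only: of_real_eq_iff)
qed

lemma integral_PiM_two_cos_power:
  fixes r n :: nat
  shows "(\<integral>t. indicator ({1..r} \<rightarrow>\<^sub>E {0..2 * pi}) t * (\<Prod>j\<in>{1..r}. 2 * cos (t j)) ^ n
      \<partial>(\<Pi>\<^sub>M j\<in>{1..r}. lborel)) =
    (2 * pi) ^ r * (if even n then of_nat (n choose (n div 2)) else 0) ^ r"
proof -
  interpret product_sigma_finite "\<lambda>_::nat. lborel :: real measure"
    by standard
  have "indicator ({1..r} \<rightarrow>\<^sub>E {0..2 * pi}) t * (\<Prod>j\<in>{1..r}. 2 * cos (t j)) ^ n =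
      (\<Prod>j\<in>{1..r}. indicator {0..2 * pi} (t j) * (2 * cos (t j)) ^ n)"
    if "t \<in> space (\<Pi>\<^sub>M j\<in>{1..r}. lborel)" for t
  proof -
    \<comment> \<open>Points of the product space are extensional, so membership in the cube is
      decided coordinatewise.\<close>
    have "indicator ({1..r} \<rightarrow>\<^sub>E {0..2 * pi}) t = (\<Prod>j\<in>{1..r}. indicator {0..2 * pi} (t j) :: real)"
      using that by (auto simp: indicator_def space_PiM PiE_iff prod_eq_1_iff intro!: prod_zero[symmetric])
    then show ?thesis
      by (simp only: prod.distrib flip: prod_power_distrib)
  qed
  then have "(\<integral>t. indicator ({1..r} \<rightarrow>\<^sub>E {0..2 * pi}) t * (\<Prod>j\<in>{1..r}. 2 * cos (t j)) ^ n
      \<partial>(\<Pi>\<^sub>M j\<in>{1..r}. lborel)) =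
      (\<integral>t. (\<Prod>j\<in>{1..r}. indicator {0..2 * pi} (t j) * (2 * cos (t j)) ^ n) \<partial>(\<Pi>\<^sub>M j\<in>{1..r}. lborel))"
    by (intro Bochner_Integration.integral_cong refl)
  also have "\<dots> = (\<Prod>j\<in>{1..r}. \<integral>t. indicator {0..2 * pi} t * (2 * cos t) ^ n \<partial>lborel)"
  proof (rule product_integral_prod)
    have "integrable lborel (\<lambda>t. indicator {0..2 * pi} t *\<^sub>R (2 * cos t) ^ n)"
      by (intro borel_integrable_compact continuous_intros) auto
    then show "integrable lborel (\<lambda>t. indicator {0..2 * pi} t * (2 * cos t) ^ n)"
      by simp
  qed simp
  finally show ?thesis
    unfolding integral_two_cos_power by (simp add: power_mult_distrib)
qed

text \<open>The law of \<open>r\<close> independent uniform angles. As a density it keeps the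
  sigma-algebra of the full product space.\<close>

definition torus_measure :: "nat \<Rightarrow> (nat \<Rightarrow> real) measure" where
  "torus_measure r = density (\<Pi>\<^sub>M j\<in>{1..r}. lborel)
     (\<lambda>t. ennreal (indicator ({1..r} \<rightarrow>\<^sub>E {0..2 * pi}) t / (2 * pi) ^ r))"

lemma PiE_cube_measurable [measurable]:
  "({1..r::nat} \<rightarrow>\<^sub>E {0..2 * pi}) \<in> sets (\<Pi>\<^sub>M j\<in>{1..r}. lborel)"
  by (intro sets_PiM_I_finite) auto

lemma integral_torus_measure:
  fixes f :: "(nat \<Rightarrow> real) \<Rightarrow> real"
  assumes [measurable]: "f \<in> borel_measurable (\<Pi>\<^sub>M j\<in>{1..r}. lborel)"
  shows "(\<integral>t. f t \<partial>torus_measure r) =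
    (\<integral>t. indicator ({1..r} \<rightarrow>\<^sub>E {0..2 * pi}) t * f t \<partial>(\<Pi>\<^sub>M j\<in>{1..r}. lborel)) / (2 * pi) ^ r"
  unfolding torus_measure_def by (subst integral_density) (auto simp del: One_nat_def)

lemma finite_measure_torus_measure: "finite_measure (torus_measure r)"
proof (rule finite_measureI)
  interpret product_sigma_finite "\<lambda>_::nat. lborel :: real measure"
    by standard
  let ?S = "{1..r} \<rightarrow>\<^sub>E {0..2 * pi}"
  have "emeasure (torus_measure r) (space (torus_measure r)) =
      (\<integral>\<^sup>+t. ennreal (indicator ?S t / (2 * pi) ^ r) \<partial>(\<Pi>\<^sub>M j\<in>{1..r}. lborel))"
    unfolding torus_measure_def by (subst emeasure_density) (auto intro!: nn_integral_cong)
  also have "\<dots> = (\<integral>\<^sup>+t. ennreal (1 / (2 * pi) ^ r) * indicator ?S t \<partial>(\<Pi>\<^sub>M j\<in>{1..r}. lborel))"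
    by (intro nn_integral_cong) (auto simp: indicator_def)
  also have "\<dots> = ennreal (1 / (2 * pi) ^ r) * emeasure (\<Pi>\<^sub>M j\<in>{1..r}. lborel) ?S"
    by (intro nn_integral_cmult_indicator) measurable
  also have "emeasure (\<Pi>\<^sub>M j\<in>{1..r}. lborel) ?S = ennreal (2 * pi) ^ r"
    by (subst emeasure_PiM) auto
  finally show "emeasure (torus_measure r) (space (torus_measure r)) \<noteq> \<infinity>"
    by (simp add: ennreal_mult_eq_top_iff ennreal_power)
qed

text \<open>A sign \<open>\<sigma>\<close> only affects odd powers, whose integrals vanish
  anyway.\<close>

lemma binomial_moments_torus:
  assumes "1 \<le> r" "\<bar>\<sigma>\<bar> = 1"
  shows "binomial_moments (torus_measure r) r (\<lambda>t. \<sigma> * (\<Prod>j\<in>{1..r}. 2 * cos (t j)))"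
proof -
  interpret finite_measure "torus_measure r"
    by (rule finite_measure_torus_measure)
  have [measurable]: "(\<lambda>t. \<Prod>j\<in>{1..r}. 2 * cos (t j) :: real) \<in> borel_measurable (\<Pi>\<^sub>M j\<in>{1..r}. lborel)"
    by measurable
  show ?thesis
  proof
    show "1 \<le> r" by fact
    show "(\<lambda>t. \<sigma> * (\<Prod>j\<in>{1..r}. 2 * cos (t j))) \<in> borel_measurable (torus_measure r)"
      by (simp add: torus_measure_def)
    show "\<bar>\<sigma> * (\<Prod>j\<in>{1..r}. 2 * cos (t j))\<bar> \<le> 2 ^ r" for t :: "nat \<Rightarrow> real"
      using prod_mono[of "{1..r}" "\<lambda>j. \<bar>2 * cos (t j)\<bar>" "\<lambda>_. 2"] assms(2)
      by (simp add: abs_mult abs_prod)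
    fix n
    have "(\<integral>t. (\<sigma> * (\<Prod>j\<in>{1..r}. 2 * cos (t j))) ^ n \<partial>torus_measure r) =
        \<sigma> ^ n * (\<integral>t. (\<Prod>j\<in>{1..r}. 2 * cos (t j)) ^ n \<partial>torus_measure r)"
      by (simp add: power_mult_distrib)
    also have "\<dots> = \<sigma> ^ n * (if even n then of_nat (n choose (n div 2)) else 0) ^ r"
      by (subst integral_torus_measure)
        (simp_all add: integral_PiM_two_cos_power power_mult_distrib del: One_nat_def)
    \<comment> \<open>For odd \<open>n\<close> the power \<open>0 ^ r\<close> is 0 only because
      \<open>1 \<le> r\<close>.\<close>
    also have "\<dots> = (if even n then of_nat (n choose (n div 2)) ^ r else 0)"
      using assms by (auto simp: power_even_abs[of n \<sigma>, symmetric])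
    finally show "(\<integral>t. (\<sigma> * (\<Prod>j\<in>{1..r}. 2 * cos (t j))) ^ n \<partial>torus_measure r) =
        (if even n then of_nat (n choose (n div 2)) ^ r else 0)" .
  qed
qed

text \<open>On the circle \<open>x j + inverse (x j)\<close> is \<open>2 * cos (t j)\<close> and
  each dx/x is \<open>\<i>\<close> dt; the factor \<open>\<i> ^ r\<close> cancels, and the remaining
  \<open>(2 * pi) ^ r\<close> is the normalisation of the measure.\<close>

lemma W_eq_integral_torus_measure:
  "W r k s = of_real (\<integral>t. \<bar>k + (\<Prod>j\<in>{1..r}. 2 * cos (t j))\<bar> powr s \<partial>torus_measure r)"
proof -
  let ?S = "{1..r} \<rightarrow>\<^sub>E {0..2 * pi}" and ?P = "\<Pi>\<^sub>M j\<in>{1..r}. lborel :: real measure"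
  have cis: "cis u + inverse (cis u) = of_real (2 * cos u)" for u
    by (simp add: complex_eq_iff)
  have meas: "(\<lambda>t. \<bar>k + (\<Prod>j\<in>{1..r}. 2 * cos (t j))\<bar> powr s) \<in> borel_measurable ?P"
    by measurable
  have "of_real (cmod (of_real k + (\<Prod>j\<in>{1..r}. cis (t j) + inverse (cis (t j)))) powr s) /
       (\<Prod>j\<in>{1..r}. cis (t j)) * (\<Prod>j\<in>{1..r}. \<i> * cis (t j)) =
     \<i> ^ r * of_real (\<bar>k + (\<Prod>j\<in>{1..r}. 2 * cos (t j))\<bar> powr s)" for t
  proof -
    have "cmod (of_real k + (\<Prod>j\<in>{1..r}. cis (t j) + inverse (cis (t j)))) =
        \<bar>k + (\<Prod>j\<in>{1..r}. 2 * cos (t j))\<bar>"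
      unfolding cis of_real_prod[symmetric] of_real_add[symmetric] norm_of_real ..
    moreover have "(\<Prod>j\<in>{1..r}. cis (t j)) \<noteq> 0"
      by (simp add: prod_zero_iff)
    ultimately show ?thesis
      by (simp add: prod.distrib)
  qed
  then have "torus_integral r (\<lambda>x.
       of_real (cmod (of_real k + (\<Prod>j\<in>{1..r}. x j + inverse (x j))) powr s) / (\<Prod>j\<in>{1..r}. x j)) =
     (\<integral>t. indicator ?S t *\<^sub>R (\<i> ^ r * of_real (\<bar>k + (\<Prod>j\<in>{1..r}. 2 * cos (t j))\<bar> powr s)) \<partial>?P)"
    by (simp only: torus_integral_def set_lebesgue_integral_def)
  also have "\<dots> = \<i> ^ r * (\<integral>t. of_real (indicator ?S t * \<bar>k + (\<Prod>j\<in>{1..r}. 2 * cos (t j))\<bar> powr s) \<partial>?P)"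
    unfolding integral_mult_right_zero[symmetric]
    by (simp add: scaleR_conv_of_real mult_ac)
  also have "\<dots> = \<i> ^ r * of_real ((2 * pi) ^ r * (\<integral>t. \<bar>k + (\<Prod>j\<in>{1..r}. 2 * cos (t j))\<bar> powr s \<partial>torus_measure r))"
    unfolding integral_torus_measure[OF meas] integral_complex_of_real by simp
  finally show ?thesis
    by (simp add: W_def power_mult_distrib)
qed

theorem theorem1p5:
  fixes r :: nat and s k :: real
  assumes "1 \<le> r" and "0 < s" and "\<not> (\<exists>n::int. odd n \<and> s = of_int n)"
  shows "W r k s = of_real (Re (powF r s k) + tan (pi * s / 2) * Im (powF r s k))"
proof -
  \<comment> \<open>\<open>- X\<close> has the same moments as \<open>X\<close>, hence the same continuation; this covers negative \<open>k\<close>.\<close>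
  define \<sigma> :: real where "\<sigma> = (if 0 \<le> k then 1 else -1)"
  interpret binomial_moments "torus_measure r" r "\<lambda>t. \<sigma> * (\<Prod>j\<in>{1..r}. 2 * cos (t j))"
    using assms(1) by (rule binomial_moments_torus) (simp add: \<sigma>_def)
  have "\<bar>\<bar>k\<bar> + \<sigma> * y\<bar> = \<bar>k + y\<bar>" for y
    by (cases "0 \<le> k") (simp_all add: \<sigma>_def)
  then show ?thesis
    unfolding W_eq_integral_torus_measure using integral_abs_powr[of s k] assms(2,3)
    by (auto simp del: of_real_add of_real_mult)
qed

end
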